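(* Let $N\ge1$ and let $\gamma=(\gamma_1,\dots,\gamma_N)\in\mathbb C^N$ be a fixed point of the Ulam map $\psi^{(N)}$ whose components $\gamma_n$ are pairwise distinct. Then $\gamma$ is an asymptotically stable equilibrium of the (solvable) nonlinear dynamical system $$\dot\zeta_n(t)=-\left[\prod_{\ell=1,\,\ell\ne n}^N(\zeta_n-\zeta_\ell)^{-1}\right]\left[\zeta_n^N+\sum_{m=1}^N\gamma_m\zeta_n^{N-m}\right],\quad n=1,\dots,N,$$ for $\zeta(t)=(\zeta_1(t),\dots,\zeta_N(t))\in\mathbb C^N$.
   Context: The Ulam map $\psi^{(N)}:\mathbb C^N\to\mathbb C^N$ is $(c_1,\dots,c_N)\mapsto(-s_1^{(N)},s_2^{(N)},\dots,(-1)^Ns_N^{(N)})$, where $s_j^{(N)}$ is the $j$-th elementary symmetric polynomial in $c_1,\dots,c_N$. Thus $\gamma$ is a fixed point iff $z^N+\sum_{m=1}^N\gamma_mz^{N-m}=\prod_{n=1}^N(z-\gamma_n)$. The system is considered with real time $t$ on the open set of $\zeta\in\mathbb C^N$ with pairwise distinct components. It is called solvable because finding its solutions reduces to finding the zeros $\zeta_n(t)$ of the polynomial $e^tz^N+\sum_{m=1}^N[\gamma_m(e^t+a)+b_m]z^{N-m}=e^t\prod_{n=1}^N(z-\zeta_n(t))$, with constants $a,b_1,\dots,b_N$; this is only a descriptive term here. Asymptotic stability has its usual meaning for equilibria of autonomous ODEs (Lyapunov stable, and solutions starting sufficiently close to $\gamma$ converge to $\gamma$ as $t\to\infty$). *)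

theory Defs
  imports "HOL-Analysis.Analysis"
begin

section \<open>The Ulam map\<close>

text \<open>
  \<open>\<complex>\<^sup>N\<close> is \<^typ>\<open>complex ^ 'n\<close> for a finite linearly ordered index type \<open>'n\<close> with
  \<open>N = CARD('n)\<close>. The order is needed because the \<open>m\<close>-th component doubles as the \<open>m\<close>-th
  polynomial coefficient; \<open>pos i\<close> is the number \<open>m \<in> {1..N}\<close> of the index \<open>i\<close>.
  Every \<open>N \<ge> 1\<close> occurs, e.g. as a numeral type.
\<close>

definition pos :: "'n::{finite,linorder} \<Rightarrow> nat" where
  "pos i = card {..i}"

lemma strict_mono_pos: "strict_mono (pos :: 'n::{finite,linorder} \<Rightarrow> nat)"
  unfolding strict_mono_def pos_def by (auto intro!: psubset_card_mono)

lemma bij_betw_pos: "bij_betw (pos :: 'n::{finite,linorder} \<Rightarrow> nat) UNIV {1..CARD('n)}"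
proof -
  have inj: "inj (pos :: 'n \<Rightarrow> nat)"
    using strict_mono_pos by (rule strict_mono_imp_inj_on)
  have "range (pos :: 'n \<Rightarrow> nat) \<subseteq> {1..CARD('n)}"
  proof
    fix k assume "k \<in> range (pos :: 'n \<Rightarrow> nat)"
    then obtain i :: 'n where k: "k = card {..i}" by (auto simp: pos_def)
    have "0 < card {..i}" by (subst card_gt_0_iff) auto
    moreover have "card {..i} \<le> CARD('n)" by (rule card_mono) auto
    ultimately show "k \<in> {1..CARD('n)}" using k by simp
  qed
  moreover have "card (range (pos :: 'n \<Rightarrow> nat)) = card {1..CARD('n)}"
    using card_image[OF inj] by simp
  ultimately have "range (pos :: 'n \<Rightarrow> nat) = {1..CARD('n)}"
    by (intro card_subset_eq) auto
  with inj show ?thesis by (simp add: bij_betw_def)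
qed

definition elem_sym :: "nat \<Rightarrow> complex ^ 'n::finite \<Rightarrow> complex" where
  "elem_sym k c = (\<Sum>A | card A = k. \<Prod>i\<in>A. c $ i)"

definition ulam_map :: "complex ^ 'n::{finite,linorder} \<Rightarrow> complex ^ 'n::{finite,linorder}" where
  "ulam_map c = (\<chi> j. (-1) ^ pos j * elem_sym (pos j) c)"


section \<open>Asymptotic stability of equilibria of autonomous ODEs\<close>

text \<open>
  \<open>ode_solution F D x J\<close>: on the time set \<open>J\<close>, \<open>x\<close> stays in the phase space \<open>D\<close> and solves
  \<open>x' = F(x)\<close>, with one-sided derivatives at endpoints of \<open>J\<close>.
\<close>

definition ode_solution ::
    "('a::real_normed_vector \<Rightarrow> 'a) \<Rightarrow> 'a set \<Rightarrow> (real \<Rightarrow> 'a) \<Rightarrow> real set \<Rightarrow> bool" where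
  "ode_solution F D x J \<longleftrightarrow>
     (\<forall>t\<in>J. x t \<in> D \<and> (x has_vector_derivative F (x t)) (at t within J))"

definition equilibrium :: "('a::real_normed_vector \<Rightarrow> 'a) \<Rightarrow> 'a set \<Rightarrow> 'a \<Rightarrow> bool" where
  "equilibrium F D p \<longleftrightarrow> p \<in> D \<and> F p = 0"

text \<open>
  Lyapunov stability includes that initial values near \<open>p\<close> admit a solution for all \<open>t \<ge> 0\<close>.
  The closeness condition is imposed on all forward solutions, including those given
  only on a shorter interval.
\<close>

definition lyapunov_stable :: "('a::real_normed_vector \<Rightarrow> 'a) \<Rightarrow> 'a set \<Rightarrow> 'a \<Rightarrow> bool" where
  "lyapunov_stable F D p \<longleftrightarrow>
     (\<forall>\<epsilon>>0. \<exists>\<delta>>0. \<forall>x0\<in>D. dist x0 p < \<delta> \<longrightarrow>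
        (\<exists>x. x 0 = x0 \<and> ode_solution F D x {0..}) \<and>
        (\<forall>x J. is_interval J \<and> 0 \<in> J \<and> J \<subseteq> {0..} \<and> x 0 = x0 \<and> ode_solution F D x J \<longrightarrow>
           (\<forall>t\<in>J. dist (x t) p < \<epsilon>)))"

definition attractive :: "('a::real_normed_vector \<Rightarrow> 'a) \<Rightarrow> 'a set \<Rightarrow> 'a \<Rightarrow> bool" where
  "attractive F D p \<longleftrightarrow>
     (\<exists>\<delta>>0. \<forall>x. ode_solution F D x {0..} \<and> dist (x 0) p < \<delta> \<longrightarrow> (x \<longlongrightarrow> p) at_top)"

definition asymptotically_stable_equilibrium ::
    "('a::real_normed_vector \<Rightarrow> 'a) \<Rightarrow> 'a set \<Rightarrow> 'a \<Rightarrow> bool" where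
  "asymptotically_stable_equilibrium F D p \<longleftrightarrow>
     equilibrium F D p \<and> lyapunov_stable F D p \<and> attractive F D p"


section \<open>The dynamical system\<close>

definition distinct_components :: "(complex ^ 'n::finite) set" where
  "distinct_components = {\<zeta>. \<forall>i j. i \<noteq> j \<longrightarrow> \<zeta> $ i \<noteq> \<zeta> $ j}"

definition ulam_field ::
    "complex ^ 'n::{finite,linorder} \<Rightarrow> complex ^ 'n::{finite,linorder}
      \<Rightarrow> complex ^ 'n::{finite,linorder}" where
  "ulam_field \<gamma> \<zeta> = (\<chi> n.
     - (\<Prod>l\<in>UNIV - {n}. inverse (\<zeta> $ n - \<zeta> $ l)) *
       (\<zeta> $ n ^ CARD('n) + (\<Sum>m\<in>UNIV. \<gamma> $ m * \<zeta> $ n ^ (CARD('n) - pos m))))"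

end

theory Submission
  imports Defs
begin

text \<open>
  Let \<open>p\<close> be the monic polynomial with zeros \<open>\<gamma>\<^sub>n\<close>; the fixed point property says that
  the bracket in the system is \<open>p(\<zeta>\<^sub>n)\<close>. Lagrange interpolation of \<open>p - q\<close>, where
  \<open>q(z) = \<Prod>\<^sub>n (z - \<zeta>\<^sub>n)\<close>, shows that along solutions \<open>q' = p - q\<close>. Hence the map \<open>\<Phi>\<close> with
  \<open>\<Phi>(\<zeta>)\<^sub>k = q(\<gamma>\<^sub>k)\<close> turns the system into \<open>y' = - y\<close>. The derivative of \<open>\<Phi>\<close> at \<open>\<gamma>\<close> is diagonal
  with nonzero entries, so by the inverse function theorem \<open>\<Phi>\<close> is a local diffeomorphism,
  and asymptotic stability of \<open>0\<close> for \<open>y' = - y\<close> is transported to \<open>\<gamma>\<close>.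
\<close>

section \<open>Stability from a linearizing change of coordinates\<close>

text \<open>By the chain rule \<open>lin\<close> says that \<open>f\<close> sends solutions to
  solutions of y' = -y. The inverse function theorem supplies a local inverse \<open>g\<close>,
  which carries the explicit flow exp(-t) y back to a neighbourhood of \<open>p\<close>. Since
  \<open>f\<close> may fail to be injective on \<open>D\<close>, solutions must also be shown not to
  leave \<open>U\<close>.\<close>

lemma asymptotically_stable_equilibrium_if_linearized:
  fixes f :: "'a::euclidean_space \<Rightarrow> 'a" and f' :: "'a \<Rightarrow> 'a \<Rightarrow>\<^sub>L 'a"
  assumes "open D" "p \<in> D"
    and deriv: "\<And>x. x \<in> D \<Longrightarrow> (f has_derivative blinfun_apply (f' x)) (at x)"
    and cont: "continuous_on D f'"
    and inv: "invf o\<^sub>L f' p = id_blinfun"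
    and fp: "f p = 0"
    and lin: "\<And>x. x \<in> D \<Longrightarrow> f' x (F x) = - f x"
  shows "asymptotically_stable_equilibrium F D p"
proof -
  obtain U V g g' where UV: "open U" "U \<subseteq> D" "p \<in> U" "open V" "f p \<in> V"
    and hom: "homeomorphism U V f g"
    and g': "\<And>y. y \<in> V \<Longrightarrow> (g has_derivative g' y) (at y)"
    and g'_eq: "\<And>y. y \<in> V \<Longrightarrow> g' y = Hilbert_Choice.inv (blinfun_apply (f' (g y)))"
    and bij: "\<And>y. y \<in> V \<Longrightarrow> bij (blinfun_apply (f' (g y)))"
    using inverse_function_theorem[OF \<open>open D\<close> deriv cont \<open>p \<in> D\<close> inv] by blast
  have gf: "g (f x) = x" if "x \<in> U" for x
    using hom that by (auto simp: homeomorphism_def)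
  have gU: "g y \<in> U" and fg: "f (g y) = y" if "y \<in> V" for y
    using hom that by (auto simp: homeomorphism_def)
  have g0: "g 0 = p" using gf[OF UV(3)] fp by simp
  have contg: "isCont g y" if "y \<in> V" for y
    using g'[OF that] has_derivative_continuous by blast
  \<comment> \<open>\<open>F\<close> is the image of the field y \<mapsto> -y under
    \<open>g\<close>: invert \<open>f' (g y)\<close> in \<open>lin\<close>.\<close>
  have F_eq: "g' y (- y) = F (g y)" if "y \<in> V" for y
  proof -
    have "f' (g y) (F (g y)) = - y"
      using lin[of "g y"] gU[OF that] fg[OF that] UV(2) by auto
    then show ?thesis
      using bij[OF that] by (metis g'_eq[OF that] bij_inv_eq_iff)
  qed
  have F0: "F p = 0"
  proof -
    have "linear (g' 0)" using g'[of 0] UV(5) fp has_derivative_linear by auto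
    then have "g' 0 0 = 0" by (rule linear_0)
    then show ?thesis using F_eq[of 0] UV(5) fp g0 by auto
  qed
  \<comment> \<open>Integrating factor: \<open>exp t *\<^sub>R f (x t)\<close> has derivative zero
    on the interval \<open>J\<close>. This holds wherever \<open>x\<close> runs in \<open>D\<close>,
    inside \<open>U\<close> or not.\<close>
  have decay: "f (x t) = exp (- t) *\<^sub>R f (x 0)"
    if "is_interval J" "0 \<in> J" "ode_solution F D x J" "t \<in> J" for x J t
  proof -
    have "((\<lambda>t. exp t *\<^sub>R f (x t)) has_vector_derivative 0) (at t within J)" if "t \<in> J" for t
    proof -
      have x: "x t \<in> D" "(x has_vector_derivative F (x t)) (at t within J)"
        using \<open>ode_solution F D x J\<close> that by (auto simp: ode_solution_def)
      have "((f \<circ> x) has_vector_derivative f' (x t) (F (x t))) (at t within J)"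
        using x has_derivative_at_withinI[OF deriv[OF x(1)]] 
        by (intro vector_derivative_diff_chain_within)
      then have *: "((\<lambda>t. f (x t)) has_vector_derivative - f (x t)) (at t within J)"
        using lin[OF x(1)] by (simp add: o_def)
      have "((\<lambda>t. exp t *\<^sub>R f (x t)) has_vector_derivative
          exp t *\<^sub>R (- f (x t)) + exp t *\<^sub>R f (x t)) (at t within J)"
        by (rule has_vector_derivative_scaleR[OF _ *]) (auto intro!: derivative_eq_intros)
      then show ?thesis by simp
    qed
    then obtain c where c: "\<And>t. t \<in> J \<Longrightarrow> exp t *\<^sub>R f (x t) = c"
      using has_vector_derivative_zero_constant[OF is_interval_convex[OF \<open>is_interval J\<close>],
          of "\<lambda>t. exp t *\<^sub>R f (x t)"] by blast
    then have eq: "exp t *\<^sub>R f (x t) = f (x 0)"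
      using c[OF that(2)] c[OF that(4)] by simp
    show ?thesis by (simp add: eq[symmetric] exp_minus)
  qed
  \<comment> \<open>Balls around 0 are forward invariant under y' = -y, so controlling
    \<open>norm (f x)\<close> at time 0 suffices: below \<open>r\<close> the curve stays in
    \<open>V\<close>, below \<open>s\<close> its image under \<open>g\<close> is close to
    \<open>p\<close>.\<close>
  have small: "\<exists>\<delta>>0. ball p \<delta> \<subseteq> U \<and> (\<forall>x\<in>ball p \<delta>. \<forall>t\<ge>0.
      exp (- t) *\<^sub>R f x \<in> V \<and> dist (g (exp (- t) *\<^sub>R f x)) p < \<epsilon>)" if "\<epsilon> > 0" for \<epsilon>
  proof -
    obtain r where r: "r > 0" "ball 0 r \<subseteq> V"
      using UV(4,5) fp open_contains_ball by metis
    have "isCont g 0" using contg UV(5) fp by simp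
    then obtain s where s: "s > 0" "\<And>y. norm y < s \<Longrightarrow> dist (g y) p < \<epsilon>"
      using \<open>\<epsilon> > 0\<close> unfolding continuous_at_eps_delta g0 dist_norm diff_zero by blast
    have "0 < min r s" using r(1) s(1) by simp
    moreover have "isCont f p" using deriv[OF \<open>p \<in> D\<close>] has_derivative_continuous by blast
    ultimately obtain d where d: "d > 0" "\<And>x. dist x p < d \<Longrightarrow> norm (f x) < min r s"
      unfolding continuous_at_eps_delta fp dist_norm diff_zero by blast
    obtain e where e: "e > 0" "ball p e \<subseteq> U"
      using UV open_contains_ball by metis
    show ?thesis
    proof (intro exI[of _ "min d e"] conjI ballI allI impI)
      fix x and t :: real assume x: "x \<in> ball p (min d e)" and "0 \<le> t"
      have "norm (exp (- t) *\<^sub>R f x) \<le> 1 * norm (f x)"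
        using \<open>0 \<le> t\<close> by (simp only: norm_scaleR, intro mult_right_mono) auto
      also have "\<dots> < min r s" using d x by (simp add: dist_commute)
      finally show "exp (- t) *\<^sub>R f x \<in> V" "dist (g (exp (- t) *\<^sub>R f x)) p < \<epsilon>"
        using r s by (auto simp: subset_iff)
    qed (use d e in auto)
  qed
  \<comment> \<open>\<open>decay\<close> determines only \<open>f (x t)\<close>; recovering
    \<open>x t\<close> needs \<open>x t \<in> U\<close>. The times with this property form an open
    set, as \<open>U\<close> is open, and a closed one, as there \<open>x\<close> coincides with a
    continuous curve. They include 0, so connectedness of \<open>J\<close> gives all of
    \<open>J\<close>.\<close>
  have rep: "x t = g (exp (- t) *\<^sub>R f (x 0))"
    if J: "is_interval J" "0 \<in> J" "t \<in> J" and x: "ode_solution F D x J" "x 0 \<in> U"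
      and V: "\<And>t. t \<in> J \<Longrightarrow> exp (- t) *\<^sub>R f (x 0) \<in> V" for x J t
  proof -
    have cx: "continuous_on J x"
      using x(1) by (auto simp: ode_solution_def continuous_on_eq_continuous_within
          intro: has_vector_derivative_continuous)
    have cg: "continuous_on J (\<lambda>t. g (exp (- t) *\<^sub>R f (x 0)))"
      by (rule continuous_on_compose2[of V g])
        (use V contg in \<open>auto intro!: continuous_at_imp_continuous_on continuous_intros\<close>)
    have iff: "x t \<in> U \<longleftrightarrow> x t - g (exp (- t) *\<^sub>R f (x 0)) = 0" if "t \<in> J" for t
      using gf[of "x t"] gU[OF V[OF that]] decay[OF J(1,2) x(1) that] by auto
    have "{t \<in> J. x t \<in> U} = J \<inter> x -` U" by auto
    then have "openin (top_of_set J) {t \<in> J. x t \<in> U}"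
      using continuous_openin_preimage_gen[OF cx UV(1)] by simp
    moreover have "{t \<in> J. x t \<in> U} = {t \<in> J. x t - g (exp (- t) *\<^sub>R f (x 0)) = 0}"
      using iff by auto
    then have "closedin (top_of_set J) {t \<in> J. x t \<in> U}"
      using continuous_closedin_preimage_constant[OF continuous_on_diff[OF cx cg], of 0] by simp
    moreover have "0 \<in> {t \<in> J. x t \<in> U}" using J x by simp
    ultimately have "{t \<in> J. x t \<in> U} = J"
      using is_interval_connected[OF J(1)] unfolding connected_clopen by blast
    then show ?thesis using iff[OF J(3)] J(3) by auto
  qed
  have "lyapunov_stable F D p"
    unfolding lyapunov_stable_def
  proof (intro allI impI)
    fix \<epsilon> :: real assume "\<epsilon> > 0"
    from small[OF this] obtain \<delta> where \<delta>: "\<delta> > 0" "ball p \<delta> \<subseteq> U"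
      and V: "\<And>x t. x \<in> ball p \<delta> \<Longrightarrow> 0 \<le> t \<Longrightarrow> exp (- t) *\<^sub>R f x \<in> V"
      and d: "\<And>x t. x \<in> ball p \<delta> \<Longrightarrow> 0 \<le> t \<Longrightarrow> dist (g (exp (- t) *\<^sub>R f x)) p < \<epsilon>"
      by blast
    show "\<exists>\<delta>>0. \<forall>x0\<in>D. dist x0 p < \<delta> \<longrightarrow>
        (\<exists>x. x 0 = x0 \<and> ode_solution F D x {0..}) \<and>
        (\<forall>x J. is_interval J \<and> 0 \<in> J \<and> J \<subseteq> {0..} \<and> x 0 = x0 \<and> ode_solution F D x J \<longrightarrow>
           (\<forall>t\<in>J. dist (x t) p < \<epsilon>))"
    proof (intro exI[of _ \<delta>] conjI ballI allI impI \<delta>)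
      fix x0 assume "dist x0 p < \<delta>"
      then have x0: "x0 \<in> ball p \<delta>" by (simp add: dist_commute)
      \<comment> \<open>Existence for all t \<ge> 0: the explicit solution of y' = -y pulled back by
        \<open>g\<close>, with \<open>F_eq\<close> identifying its velocity.\<close>
      define x where "x t = g (exp (- t) *\<^sub>R f x0)" for t
      have "ode_solution F D x {0..}"
        unfolding ode_solution_def
      proof (intro ballI conjI)
        fix t :: real assume "t \<in> {0..}"
        then have v: "exp (- t) *\<^sub>R f x0 \<in> V" using V[OF x0] by simp
        then show "x t \<in> D" using gU UV(2) by (auto simp: x_def)
        have "((\<lambda>t. exp (- t) *\<^sub>R f x0) has_vector_derivative - (exp (- t) *\<^sub>R f x0))
            (at t within {0..})"
          by (auto intro!: derivative_eq_intros simp: has_vector_derivative_def)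
        from vector_derivative_diff_chain_within[OF this has_derivative_at_withinI[OF g'[OF v]]]
        show "(x has_vector_derivative F (x t)) (at t within {0..})"
          using F_eq[OF v] by (simp add: x_def[abs_def] o_def)
      qed
      moreover have "x 0 = x0" using gf \<delta> x0 by (auto simp: x_def)
      ultimately show "\<exists>x. x 0 = x0 \<and> ode_solution F D x {0..}" by blast
    next
      fix x0 x J t
      assume "dist x0 p < \<delta>" "t \<in> J"
        and J: "is_interval J \<and> 0 \<in> J \<and> J \<subseteq> {0..} \<and> x 0 = x0 \<and> ode_solution F D x J"
      then have x0: "x 0 \<in> ball p \<delta>" by (simp add: dist_commute)
      have "x t = g (exp (- t) *\<^sub>R f (x 0))"
        by (rule rep[of J]) (use J \<open>t \<in> J\<close> V[OF x0] x0 \<delta> in auto)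
      then show "dist (x t) p < \<epsilon>" using d[OF x0, of t] J \<open>t \<in> J\<close> by auto
    qed
  qed
  moreover have "attractive F D p"
  proof -
    \<comment> \<open>Any positive bound serves here: what matters is that the curves stay in
      \<open>V\<close>, so that \<open>rep\<close> applies on all of \<open>{0..}\<close>.\<close>
    from small[of 1] obtain \<delta> where \<delta>: "\<delta> > 0" "ball p \<delta> \<subseteq> U"
      and V: "\<And>x t. x \<in> ball p \<delta> \<Longrightarrow> 0 \<le> t \<Longrightarrow> exp (- t) *\<^sub>R f x \<in> V"
      by auto
    have "(x \<longlongrightarrow> p) at_top" if x: "ode_solution F D x {0..}" and "dist (x 0) p < \<delta>" for x
    proof -
      have x0: "x 0 \<in> ball p \<delta>" using that by (simp add: dist_commute)
      have "x t = g (exp (- t) *\<^sub>R f (x 0))" if "t \<ge> 0" for t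
        by (rule rep[of "{0..}"]) (use that V[OF x0] x x0 \<delta> in auto)
      then have ev: "\<forall>\<^sub>F t in at_top. g (exp (- t) *\<^sub>R f (x 0)) = x t"
        unfolding eventually_at_top_linorder by metis
      have "((\<lambda>t::real. exp (- t)) \<longlongrightarrow> 0) at_top"
        by (rule filterlim_compose[OF exp_at_bot filterlim_uminus_at_bot_at_top])
      from tendsto_scaleR[OF this tendsto_const]
      have "((\<lambda>t. exp (- t) *\<^sub>R f (x 0)) \<longlongrightarrow> 0) at_top" by simp
      from isCont_tendsto_compose[OF contg this] UV(5) fp
      have "((\<lambda>t. g (exp (- t) *\<^sub>R f (x 0))) \<longlongrightarrow> p) at_top" by (simp add: g0)
      then show ?thesis using ev by (rule Lim_transform_eventually)
    qed
    then show ?thesis using \<delta>(1) unfolding attractive_def by blast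
  qed
  ultimately show ?thesis
    using F0 \<open>p \<in> D\<close> by (simp add: asymptotically_stable_equilibrium_def equilibrium_def)
qed

section \<open>Phase space, Vieta's formulas and Lagrange interpolation\<close>

lemma open_distinct_components: "open (distinct_components :: (complex ^ 'n::finite) set)"
proof -
  have "distinct_components =
      (\<Inter>i. \<Inter>j\<in>- {i}. - {\<zeta> :: complex ^ 'n. \<zeta> $ i = \<zeta> $ j})"
    by (auto simp: distinct_components_def)
  also have "open \<dots>"
    by (intro open_INT ballI open_Compl closed_Collect_eq continuous_intros) auto
  finally show ?thesis .
qed

text \<open>Vieta: expand the product over subsets of the index set and group them by cardinality;
  the fixed point equation turns the signed elementary symmetric polynomials into the components of
  \<open>\<gamma>\<close>.\<close>

lemma ulam_map_fixed_point_prod: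
  fixes \<gamma> :: "complex ^ 'n::{finite,linorder}"
  assumes "ulam_map \<gamma> = \<gamma>"
  shows "z ^ CARD('n) + (\<Sum>m\<in>UNIV. \<gamma> $ m * z ^ (CARD('n) - pos m)) = (\<Prod>n\<in>UNIV. z - \<gamma> $ n)"
proof -
  let ?N = "CARD('n)"
  define c where "c k = (-1) ^ k * elem_sym k \<gamma>" for k
  have c: "c (pos m) = \<gamma> $ m" for m
    using arg_cong[OF assms, of "\<lambda>v. v $ m"] by (simp add: ulam_map_def c_def)
  have "{A :: 'n set. card A = 0} = {{}}" by auto
  then have c0: "c 0 = 1" by (simp add: c_def elem_sym_def)
  have "(\<Prod>n\<in>UNIV. z - \<gamma> $ n) = (\<Prod>n\<in>UNIV. - \<gamma> $ n + z)"
    by simp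
  also have "\<dots> = (\<Sum>A\<in>UNIV. (\<Prod>n\<in>A. - \<gamma> $ n) * z ^ (?N - card A))"
    by (subst prod_add) (auto simp: card_Diff_subset)
  also have "\<dots> = (\<Sum>A\<in>UNIV. (-1) ^ card A * (\<Prod>n\<in>A. \<gamma> $ n) * z ^ (?N - card A))"
    by (simp add: prod_uminus)
  also have "\<dots> = (\<Sum>k\<in>{..?N}. \<Sum>A | A \<in> UNIV \<and> card A = k.
      (-1) ^ card A * (\<Prod>n\<in>A. \<gamma> $ n) * z ^ (?N - card A))"
    by (rule sum.group[symmetric]) (auto intro: card_mono)
  also have "\<dots> = (\<Sum>k\<in>{..?N}. c k * z ^ (?N - k))"
    by (intro sum.cong) (auto simp: c_def elem_sym_def sum_distrib_left sum_distrib_right)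
  also have "{..?N} = insert 0 {1..?N}" by auto
  also have "(\<Sum>k\<in>insert 0 {1..?N}. c k * z ^ (?N - k)) =
      c 0 * z ^ ?N + (\<Sum>k\<in>{1..?N}. c k * z ^ (?N - k))"
    by simp
  also have "(\<Sum>k\<in>{1..?N}. c k * z ^ (?N - k)) =
      (\<Sum>m\<in>(UNIV :: 'n set). c (pos m) * z ^ (?N - pos m))"
    using sum.reindex_bij_betw[OF bij_betw_pos, of "\<lambda>k. c k * z ^ (?N - k)"] by (rule sym)
  finally show ?thesis by (simp add: c c0)
qed

lemma lagrange_interpolation_monic:
  fixes a b :: "'n::finite \<Rightarrow> 'a::field"
  assumes "inj b"
  shows "(\<Sum>n\<in>UNIV. (\<Prod>i\<in>UNIV. b n - a i) * (\<Prod>l\<in>UNIV - {n}. inverse (b n - b l)) *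
      (\<Prod>l\<in>UNIV - {n}. z - b l)) = (\<Prod>i\<in>UNIV. z - a i) - (\<Prod>i\<in>UNIV. z - b i)"
proof -
  define c where "c n = (\<Prod>i\<in>UNIV. b n - a i) * (\<Prod>l\<in>UNIV - {n}. inverse (b n - b l))" for n
  define P where "P = (\<Prod>i\<in>UNIV. [:- a i, 1:])"
  define Q where "Q = (\<Prod>i\<in>UNIV. [:- b i, 1:])"
  define L where "L n = (\<Prod>l\<in>UNIV - {n}. [:- b l, 1:])" for n
  define R where "R = (\<Sum>n\<in>UNIV. smult (c n) (L n))"
  have monic: "degree (\<Prod>i\<in>A. [:- f i, 1:]) = card A" "coeff (\<Prod>i\<in>A. [:- f i, 1:]) (card A) = 1"
    for A :: "'n set" and f :: "'n \<Rightarrow> 'a"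
  proof -
    show deg: "degree (\<Prod>i\<in>A. [:- f i, 1:]) = card A"
      by (subst degree_prod_sum_eq) auto
    show "coeff (\<Prod>i\<in>A. [:- f i, 1:]) (card A) = 1"
      using lead_coeff_prod[of "\<lambda>i. [:- f i, 1:]" A] by (simp add: deg)
  qed
  have degL: "degree (L n) < CARD('n)" for n
    by (auto simp: L_def monic card_Diff_subset)
  have degR: "degree R < CARD('n)"
    unfolding R_def by (rule degree_sum_less) (auto simp: degL intro: le_less_trans[OF degree_smult_le])
  have L0: "poly (L n) (b m) = 0" if "n \<noteq> m" for n m
    using that by (auto simp: L_def poly_prod)
  have R_b: "poly R (b m) = poly P (b m)" for m
  proof -
    have "poly R (b m) = (\<Sum>n\<in>UNIV. if n = m then c m * poly (L m) (b m) else 0)"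
      unfolding R_def poly_sum by (intro sum.cong) (auto simp: L0)
    also have "\<dots> = (\<Prod>i\<in>UNIV. b m - a i) *
        (\<Prod>l\<in>UNIV - {m}. inverse (b m - b l) * (b m - b l))"
      by (simp add: c_def L_def poly_prod prod.distrib)
    also have "(\<Prod>l\<in>UNIV - {m}. inverse (b m - b l) * (b m - b l)) = 1"
      using assms by (intro prod.neutral ballI left_inverse) (auto simp: inj_def)
    finally show ?thesis by (simp add: P_def poly_prod)
  qed
  have "R + Q = P"
  proof (rule poly_eqI_degree_lead_coeff[where n = "CARD('n)" and A = "range b"])
    show "coeff (R + Q) CARD('n) = coeff P CARD('n)"
      using degR by (simp add: P_def Q_def monic coeff_eq_0)
    show "degree (R + Q) \<le> CARD('n)"
      using degR by (intro degree_add_le) (auto simp: Q_def monic)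
    show "poly (R + Q) x = poly P x" if "x \<in> range b" for x
      using that by (auto simp: R_b Q_def poly_prod)
  qed (use assms in \<open>auto simp: P_def monic card_image\<close>)
  then have "poly R z = poly P z - poly Q z" by (metis add_diff_cancel_right' poly_diff)
  then show ?thesis
    by (simp add: R_def P_def Q_def L_def poly_sum poly_prod c_def)
qed

definition root_product_map :: "complex ^ 'n \<Rightarrow> complex ^ 'n::finite \<Rightarrow> complex ^ 'n" where
  "root_product_map \<gamma> \<zeta> = (\<chi> k. \<Prod>n\<in>UNIV. \<gamma> $ k - \<zeta> $ n)"

definition root_product_deriv ::
    "complex ^ 'n \<Rightarrow> complex ^ 'n::finite \<Rightarrow> (complex ^ 'n) \<Rightarrow>\<^sub>L (complex ^ 'n)" where
  "root_product_deriv \<gamma> \<zeta> =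
     Blinfun (\<lambda>h. \<chi> k. \<Sum>n\<in>UNIV. - h $ n * (\<Prod>l\<in>UNIV - {n}. \<gamma> $ k - \<zeta> $ l))"

lemma has_derivative_root_product_map_aux:
  "(root_product_map \<gamma> has_derivative
     (\<lambda>h. \<chi> k. \<Sum>n\<in>UNIV. - h $ n * (\<Prod>l\<in>UNIV - {n}. \<gamma> $ k - \<zeta> $ l))) (at \<zeta>)"
proof -
  have nth: "((\<lambda>z. z $ i) has_derivative (\<lambda>h. h $ i)) (at \<zeta>)" for i
    by (rule bounded_linear_imp_has_derivative[OF bounded_linear_vec_nth])
  have "((\<lambda>z. \<Prod>n\<in>UNIV. \<gamma> $ k - z $ n) has_derivative
      (\<lambda>h. \<Sum>n\<in>UNIV. - h $ n * (\<Prod>l\<in>UNIV - {n}. \<gamma> $ k - \<zeta> $ l))) (at \<zeta>)" for k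
    by (rule has_derivative_prod) (auto intro!: derivative_eq_intros nth)
  then show ?thesis
    unfolding root_product_map_def[abs_def]
    by (subst has_derivative_componentwise_within)
      (auto simp: Basis_vec_def inner_axis intro!: has_derivative_inner_left)
qed

lemma root_product_deriv_apply:
  "root_product_deriv \<gamma> \<zeta> h =
     (\<chi> k. \<Sum>n\<in>UNIV. - h $ n * (\<Prod>l\<in>UNIV - {n}. \<gamma> $ k - \<zeta> $ l))"
  unfolding root_product_deriv_def
  using has_derivative_bounded_linear[OF has_derivative_root_product_map_aux]
  by (rule bounded_linear_Blinfun_apply[THEN fun_cong])

lemma has_derivative_root_product_map:
  "(root_product_map \<gamma> has_derivative root_product_deriv \<gamma> \<zeta>) (at \<zeta>)"
  using has_derivative_root_product_map_aux by (simp add: root_product_deriv_apply[abs_def])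

lemma continuous_on_root_product_deriv: "continuous_on S (root_product_deriv \<gamma>)"
  by (rule continuous_on_blinfun_componentwise, unfold root_product_deriv_apply,
      intro continuous_on_vec_lambda continuous_on_sum continuous_on_mult continuous_on_prod
        continuous_on_diff continuous_on_const continuous_on_component continuous_on_id)

lemma root_product_deriv_left_inverse:
  assumes "\<gamma> \<in> distinct_components"
  shows "\<exists>invf. invf o\<^sub>L root_product_deriv \<gamma> \<gamma> = id_blinfun"
proof -
  define d where "d k = (\<Prod>l\<in>UNIV - {k}. \<gamma> $ k - \<gamma> $ l)" for k
  have d: "d k \<noteq> 0" for k
    using assms by (auto simp: d_def distinct_components_def)
  have off: "(\<Prod>l\<in>UNIV - {n}. \<gamma> $ k - \<gamma> $ l) = 0" if "n \<noteq> k" for n k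
    using that by (auto intro!: prod_zero)
  have "(\<Sum>n\<in>UNIV. - h $ n * (\<Prod>l\<in>UNIV - {n}. \<gamma> $ k - \<gamma> $ l)) = - h $ k * d k" for h k
  proof -
    have "(\<Sum>n\<in>UNIV. - h $ n * (\<Prod>l\<in>UNIV - {n}. \<gamma> $ k - \<gamma> $ l)) =
        (\<Sum>n\<in>UNIV. if n = k then - h $ k * d k else 0)"
      by (intro sum.cong) (auto simp: off d_def)
    then show ?thesis by simp
  qed
  then have deriv: "root_product_deriv \<gamma> \<gamma> h = (\<chi> k. - h $ k * d k)" for h
    by (simp add: root_product_deriv_apply)
  have bl: "bounded_linear (\<lambda>h :: complex ^ 'a. \<chi> k. - (h $ k / d k))"
    by (intro linear_conv_bounded_linear[THEN iffD1] linearI)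
      (auto simp: vec_eq_iff add_divide_distrib scaleR_conv_of_real)
  have "Blinfun (\<lambda>h. \<chi> k. - (h $ k / d k)) o\<^sub>L root_product_deriv \<gamma> \<gamma> = id_blinfun"
    by (rule blinfun_eqI) (simp add: bounded_linear_Blinfun_apply[OF bl] deriv d vec_eq_iff)
  then show ?thesis by blast
qed

lemma root_product_deriv_ulam_field:
  assumes "ulam_map \<gamma> = \<gamma>" "\<zeta> \<in> distinct_components"
  shows "root_product_deriv \<gamma> \<zeta> (ulam_field \<gamma> \<zeta>) = - root_product_map \<gamma> \<zeta>"
proof -
  have "inj (($) \<zeta>)" using assms(2) by (auto simp: distinct_components_def inj_def)
  note lagrange = lagrange_interpolation_monic[OF this, of "($) \<gamma>"]
  have "(\<Sum>n\<in>UNIV. (\<Prod>i\<in>UNIV. \<zeta> $ n - \<gamma> $ i) *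
      (\<Prod>l\<in>UNIV - {n}. inverse (\<zeta> $ n - \<zeta> $ l)) * (\<Prod>l\<in>UNIV - {n}. \<gamma> $ k - \<zeta> $ l)) =
      - (\<Prod>i\<in>UNIV. \<gamma> $ k - \<zeta> $ i)" for k
  proof -
    have "(\<Prod>i\<in>UNIV. \<gamma> $ k - \<gamma> $ i) = 0" by (rule prod_zero) auto
    then show ?thesis using lagrange[of "\<gamma> $ k"] by (simp only: diff_0)
  qed
  then show ?thesis
    by (simp add: vec_eq_iff root_product_deriv_apply root_product_map_def ulam_field_def
        ulam_map_fixed_point_prod[OF assms(1)] ac_simps)
qed

theorem theorem5p1:
  fixes \<gamma> :: "complex ^ 'n::{finite,linorder}"
  assumes "ulam_map \<gamma> = \<gamma>"
    and "\<gamma> \<in> distinct_components"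
  shows "asymptotically_stable_equilibrium (ulam_field \<gamma>) distinct_components \<gamma>"
proof -
  obtain invf where "invf o\<^sub>L root_product_deriv \<gamma> \<gamma> = id_blinfun"
    using root_product_deriv_left_inverse[OF assms(2)] by blast
  moreover have "root_product_map \<gamma> \<gamma> = 0"
    by (auto simp: root_product_map_def vec_eq_iff intro!: prod_zero)
  ultimately show ?thesis
    by (rule asymptotically_stable_equilibrium_if_linearized[OF open_distinct_components assms(2)
          has_derivative_root_product_map continuous_on_root_product_deriv])
      (rule root_product_deriv_ulam_field[OF assms(1)])
qed

end
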